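(* (The First H-isomorphism Theorem) Let $\varphi:P\to Q$ be an H-homomorphism of H-groups with kernel $K=\ker\varphi$. Then the group $\pi_0(\widetilde{\varphi(P)})$ is isomorphic to the group $P/K$.
   Context: An H-group $(P,\mu,\eta,c)$ is a pointed space $(P,p_0)$ with continuous pointed maps $\mu:P\times P\to P$, $\eta:P\to P$ and the constant map $c:P\to P$ at $p_0$ such that, via pointed homotopies, $\mu(1_P,c)\simeq\mu(c,1_P)\simeq 1_P$, $\mu(\eta,1_P)\simeq\mu(1_P,\eta)\simeq c$ and $\mu(\mu\times 1_P)\simeq\mu(1_P\times\mu)$. Write $g.h=\mu(g,h)$ and $g^{-1}=\eta(g)$. The set $\pi_0(P)$ of path components is a group under $[g][h]=[g.h]$ with identity $[p_0]$. An H-homomorphism between H-groups $(P,\mu,\eta,c)$ and $(Q,\mu_2,\eta_2,c_2)$ is a continuous map $\varphi:P\to Q$ with $\varphi\mu\simeq\mu_2(\varphi\times\varphi)$ and $\varphi\eta\simeq\eta_2\varphi$. A sub-H-group of $P$ is a pointed subspace $P'\ni p_0$ which is itself an H-group (with base point $p_0$) such that the inclusion $P'\to P$ is an H-homomorphism. For $A$ a subset of an H-group $P$ and $g\in P$, write $g\,\widetilde{\in}\,A$ if there is a path in $P$ from $g$ to a point of $A$; put $\widetilde{A}=\{g\in P\mid g\,\widetilde{\in}\,A\}$. The left coset of a sub-H-group $P'$ is $gP'=\{g'\in P\mid g^{-1}.g'\,\widetilde{\in}\,P'\}$. A sub-H-group $P'$ is normal if $g.g'.g^{-1}\,\widetilde{\in}\,P'$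 for all $g\in P$, $g'\in P'$; then $P/P'=\{gP'\mid g\in P\}$ is a group under $(g_1P').(g_2P')=(g_1.g_2)P'$. Let $Q_0$ be the path component of $Q$ containing its base point. The kernel is $\ker\varphi=\{g\in P\mid \varphi(g)\,\widetilde{\in}\,Q_0\}$; it is a normal sub-H-group of $P$. The set $\widetilde{\varphi(P)}$ is a union of path components of $Q$ closed under the multiplication and inversion of $Q$, and it is an H-group with the restricted structure; $\pi_0(\widetilde{\varphi(P)})$ is thus a group under $[q][q']=[q.q']$. *)

theory Defs
  imports "HOL-Analysis.Analysis" "HOL-Algebra.Group"
begin

text \<open>
  An H-group is carried by an abstract topology \<open>P\<close>. The constant map at the base point is
  determined by \<open>p\<^sub>0\<close> and is therefore not a separate parameter. A pointed homotopy is a homotopy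
  all of whose stages send base point to base point.
\<close>

locale H_group =
  fixes P :: "'a topology" and p\<^sub>0 :: 'a
    and \<mu> :: "'a \<times> 'a \<Rightarrow> 'a" and \<eta> :: "'a \<Rightarrow> 'a"
  assumes base_point: "p\<^sub>0 \<in> topspace P"
    and continuous_mult: "continuous_map (prod_topology P P) P \<mu>"
    and continuous_inv: "continuous_map P P \<eta>"
    and pointed_mult: "\<mu> (p\<^sub>0, p\<^sub>0) = p\<^sub>0"
    and pointed_inv: "\<eta> p\<^sub>0 = p\<^sub>0"
    and right_unit: "homotopic_with (\<lambda>h. h p\<^sub>0 = p\<^sub>0) P P (\<lambda>x. \<mu> (x, p\<^sub>0)) id"
    and left_unit: "homotopic_with (\<lambda>h. h p\<^sub>0 = p\<^sub>0) P P (\<lambda>x. \<mu> (p\<^sub>0, x)) id"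
    and left_inverse: "homotopic_with (\<lambda>h. h p\<^sub>0 = p\<^sub>0) P P (\<lambda>x. \<mu> (\<eta> x, x)) (\<lambda>x. p\<^sub>0)"
    and right_inverse: "homotopic_with (\<lambda>h. h p\<^sub>0 = p\<^sub>0) P P (\<lambda>x. \<mu> (x, \<eta> x)) (\<lambda>x. p\<^sub>0)"
    and associative: "homotopic_with (\<lambda>h. h (p\<^sub>0, p\<^sub>0, p\<^sub>0) = p\<^sub>0)
          (prod_topology P (prod_topology P P)) P
          (\<lambda>(x, y, z). \<mu> (\<mu> (x, y), z)) (\<lambda>(x, y, z). \<mu> (x, \<mu> (y, z)))"

text \<open>
  H-homomorphisms are merely continuous; neither the map nor the two homotopies need be pointed.
\<close>

locale H_homomorphism =
  P: H_group P p\<^sub>0 \<mu> \<eta> + Q: H_group Q q\<^sub>0 \<mu>\<^sub>2 \<eta>\<^sub>2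
  for P :: "'a topology" and p\<^sub>0 \<mu> \<eta> and Q :: "'b topology" and q\<^sub>0 \<mu>\<^sub>2 \<eta>\<^sub>2 +
  fixes \<phi> :: "'a \<Rightarrow> 'b"
  assumes continuous_hom: "continuous_map P Q \<phi>"
    and hom_mult: "homotopic_with (\<lambda>_. True) (prod_topology P P) Q
          (\<lambda>(x, y). \<phi> (\<mu> (x, y))) (\<lambda>(x, y). \<mu>\<^sub>2 (\<phi> x, \<phi> y))"
    and hom_inv: "homotopic_with (\<lambda>_. True) P Q (\<lambda>x. \<phi> (\<eta> x)) (\<lambda>x. \<eta>\<^sub>2 (\<phi> x))"

definition tilde :: "'a topology \<Rightarrow> 'a set \<Rightarrow> 'a set" where
  "tilde X A = {g \<in> topspace X. \<exists>a\<in>A. path_component_of X g a}"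

definition H_kernel :: "'a topology \<Rightarrow> 'b topology \<Rightarrow> 'b \<Rightarrow> ('a \<Rightarrow> 'b) \<Rightarrow> 'a set" where
  "H_kernel P Q q\<^sub>0 \<phi> = {g \<in> topspace P. \<phi> g \<in> tilde Q (path_component_of_set Q q\<^sub>0)}"

definition H_coset ::
  "'a topology \<Rightarrow> ('a \<times> 'a \<Rightarrow> 'a) \<Rightarrow> ('a \<Rightarrow> 'a) \<Rightarrow> 'a set \<Rightarrow> 'a \<Rightarrow> 'a set" where
  "H_coset P \<mu> \<eta> H g = {g' \<in> topspace P. \<mu> (\<eta> g, g') \<in> tilde P H}"

text \<open>
  The quotient \<open>P/H\<close>, a group when \<open>H\<close> is a normal sub-H-group. The product of two cosets is the
  unique coset \<open>(g\<^sub>1.g\<^sub>2)H\<close> obtained from representatives; the description is meaningful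
  exactly when this does not depend on their choice.
\<close>

definition H_quotient ::
  "'a topology \<Rightarrow> 'a \<Rightarrow> ('a \<times> 'a \<Rightarrow> 'a) \<Rightarrow> ('a \<Rightarrow> 'a) \<Rightarrow> 'a set \<Rightarrow> 'a set monoid" where
  "H_quotient P p\<^sub>0 \<mu> \<eta> H =
     \<lparr>carrier = H_coset P \<mu> \<eta> H ` topspace P,
      monoid.mult = (\<lambda>A B. THE C. \<exists>g\<^sub>1\<in>topspace P. \<exists>g\<^sub>2\<in>topspace P.
        A = H_coset P \<mu> \<eta> H g\<^sub>1 \<and> B = H_coset P \<mu> \<eta> H g\<^sub>2 \<and> C = H_coset P \<mu> \<eta> H (\<mu> (g\<^sub>1, g\<^sub>2))),
      one = H_coset P \<mu> \<eta> H p\<^sub>0\<rparr>"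

text \<open>
  The group \<open>\<pi>\<^sub>0(X)\<close> of path components, with \<open>[g][h] = [g.h]\<close> expressed in the same way.
\<close>

definition pi0_group :: "'a topology \<Rightarrow> 'a \<Rightarrow> ('a \<times> 'a \<Rightarrow> 'a) \<Rightarrow> 'a set monoid" where
  "pi0_group X x\<^sub>0 \<mu> =
     \<lparr>carrier = path_components_of X,
      monoid.mult = (\<lambda>A B. THE C. \<exists>g\<in>topspace X. \<exists>h\<in>topspace X.
        A = path_component_of_set X g \<and> B = path_component_of_set X h \<and>
        C = path_component_of_set X (\<mu> (g, h))),
      one = path_component_of_set X x\<^sub>0\<rparr>"

end

theory Submission
  imports Defs
begin

text \<open>
  Everything happens up to paths: passing to path components turns the homotopies of \<open>P\<close> and \<open>Q\<close>
  into group laws and \<open>\<phi>\<close> into a homomorphism, and the coset \<open>gK\<close> becomes the full preimage under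
  \<open>\<phi>\<close> of the path component of \<open>\<phi> g\<close>. The isomorphism sends a component \<open>A\<close> of the saturated image
  to its preimage under \<open>\<phi>\<close>.
\<close>

section \<open>Groups presented by representatives\<close>

definition class_monoid :: "'a set \<Rightarrow> ('a \<Rightarrow> 'c) \<Rightarrow> ('a \<times> 'a \<Rightarrow> 'a) \<Rightarrow> 'a \<Rightarrow> 'c monoid" where
  "class_monoid S c m e =
     \<lparr>carrier = c ` S,
      monoid.mult = (\<lambda>A B. THE C. \<exists>x\<in>S. \<exists>y\<in>S. A = c x \<and> B = c y \<and> C = c (m (x, y))),
      one = c e\<rparr>"

text \<open>The common pattern of all groups below: \<open>c\<close> is either the path component
  map or the coset map, and the group laws hold only after applying \<open>c\<close>. Unit and
  inverse laws are left-handed, as \<open>groupI\<close> asks for them.\<close>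

locale group_up_to =
  fixes S :: "'a set" and c :: "'a \<Rightarrow> 'c" and m :: "'a \<times> 'a \<Rightarrow> 'a" and e :: 'a and i :: "'a \<Rightarrow> 'a"
  assumes unit_closed: "e \<in> S"
    and mult_closed: "\<And>x y. x \<in> S \<Longrightarrow> y \<in> S \<Longrightarrow> m (x, y) \<in> S"
    and inv_closed: "\<And>x. x \<in> S \<Longrightarrow> i x \<in> S"
    and mult_cong: "\<And>x x' y y'. \<lbrakk>x \<in> S; x' \<in> S; y \<in> S; y' \<in> S; c x = c x'; c y = c y'\<rbrakk>
          \<Longrightarrow> c (m (x, y)) = c (m (x', y'))"
    and assoc: "\<And>x y z. \<lbrakk>x \<in> S; y \<in> S; z \<in> S\<rbrakk> \<Longrightarrow> c (m (m (x, y), z)) = c (m (x, m (y, z)))"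
    and left_unit: "\<And>x. x \<in> S \<Longrightarrow> c (m (e, x)) = c x"
    and left_inverse: "\<And>x. x \<in> S \<Longrightarrow> c (m (i x, x)) = c e"
begin

abbreviation G where "G \<equiv> class_monoid S c m e"

lemma carrier_G: "carrier G = c ` S" and one_G: "\<one>\<^bsub>G\<^esub> = c e"
  by (simp_all add: class_monoid_def)

text \<open>By \<open>mult_cong\<close> the product does not depend on the representatives, so the
  description in \<open>class_monoid\<close> picks out exactly one class.\<close>

lemma mult_G:
  assumes "x \<in> S" "y \<in> S"
  shows "c x \<otimes>\<^bsub>G\<^esub> c y = c (m (x, y))"
proof -
  have "(THE C. \<exists>x'\<in>S. \<exists>y'\<in>S. c x = c x' \<and> c y = c y' \<and> C = c (m (x', y'))) = c (m (x, y))"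
  proof (rule the_equality)
    fix C assume "\<exists>x'\<in>S. \<exists>y'\<in>S. c x = c x' \<and> c y = c y' \<and> C = c (m (x', y'))"
    then show "C = c (m (x, y))"
      using assms mult_cong by metis
  qed (use assms in blast)
  then show ?thesis
    by (simp add: class_monoid_def)
qed

lemma group_G: "group G"
proof (rule groupI)
  fix A assume "A \<in> carrier G"
  then obtain x where "x \<in> S" "A = c x"
    by (auto simp: carrier_G)
  then show "\<exists>B\<in>carrier G. B \<otimes>\<^bsub>G\<^esub> A = \<one>\<^bsub>G\<^esub>"
    by (intro bexI[of _ "c (i x)"]) (auto simp: carrier_G one_G mult_G inv_closed left_inverse)
qed (auto simp: carrier_G one_G mult_G unit_closed mult_closed left_unit assoc)

text \<open>Since \<open>c (i x)\<close> is a left inverse of \<open>c x\<close>, cancelling it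
  compares \<open>c y\<close> with \<open>c x\<close>. This later turns the condition defining a
  coset into an equality of classes.\<close>

lemma left_quotient_eq_unit_iff:
  assumes "x \<in> S" "y \<in> S"
  shows "c (m (i x, y)) = c e \<longleftrightarrow> c x = c y"
proof -
  interpret G: group G by (rule group_G)
  have "c (i x) \<otimes>\<^bsub>G\<^esub> c x = \<one>\<^bsub>G\<^esub>"
    using assms by (simp add: mult_G inv_closed left_inverse one_G)
  moreover have "c (i x) \<in> carrier G" "c x \<in> carrier G" "c y \<in> carrier G"
    using assms by (auto simp: carrier_G inv_closed)
  ultimately have "c (i x) \<otimes>\<^bsub>G\<^esub> c y = \<one>\<^bsub>G\<^esub> \<longleftrightarrow> c x = c y"
    by (metis G.Units_l_cancel G.Units_eq)
  then show ?thesis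
    using assms by (simp add: mult_G inv_closed one_G)
qed

end

section \<open>Path components under homotopies, maps and subspaces\<close>

lemma path_component_of_set_eq_iff:
  assumes "x \<in> topspace X"
  shows "path_component_of_set X x = path_component_of_set X y \<longleftrightarrow> path_component_of X x y"
proof
  assume "path_component_of_set X x = path_component_of_set X y"
  \<comment> \<open>Membership of \<open>x\<close> matters here: points outside the space all have
    the same empty path component without being joined by a path.\<close>
  moreover have "x \<in> path_component_of_set X x"
    using assms by (simp add: path_component_of_refl)
  ultimately show "path_component_of X x y"
    by (auto intro: path_component_of_sym)
next
  assume "path_component_of X x y"
  then have "path_component_of X x = path_component_of X y"
    by (rule path_component_of_equiv[THEN iffD1, THEN conjunct2, THEN conjunct2])
  then show "path_component_of_set X x = path_component_of_set X y"
    by (rule arg_cong)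
qed

text \<open>The track of \<open>x\<close> under the homotopy is a path from \<open>f x\<close> to
  \<open>g x\<close>. Leaving \<open>R\<close> arbitrary covers pointed and free homotopies
  alike.\<close>

lemma homotopic_with_imp_path_component_of_set_eq:
  assumes "homotopic_with R X Y f g" "x \<in> topspace X"
  shows "path_component_of_set Y (f x) = path_component_of_set Y (g x)"
proof -
  obtain h where h: "continuous_map (prod_topology (top_of_set {0..1::real}) X) Y h"
      "h (0, x) = f x" "h (1, x) = g x"
    using assms(1) unfolding homotopic_with_def by blast
  have "continuous_map (top_of_set {0..1::real}) Y (h \<circ> (\<lambda>t. (t, x)))"
    using assms(2) by (intro continuous_map_compose[OF _ h(1)]) (simp add: continuous_map_pairedI)
  then have "path_component_of Y (f x) (g x)"
    unfolding path_component_of_def pathin_def using h(2,3) by (intro exI) auto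
  then show ?thesis
    by (subst path_component_of_set_eq_iff) (blast dest: path_component_in_topspace)+
qed

lemma path_component_of_set_continuous_image:
  assumes "continuous_map X Y f" "x \<in> topspace X"
    and "path_component_of_set X x = path_component_of_set X x'"
  shows "path_component_of_set Y (f x) = path_component_of_set Y (f x')"
proof -
  have "path_component_of Y (f x) (f x')"
    using assms by (auto simp: path_component_of_set_eq_iff intro: path_component_of_continuous_image)
  then show ?thesis
    by (subst path_component_of_set_eq_iff) (blast dest: path_component_in_topspace)+
qed

text \<open>The set \<open>tilde X A\<close> is a union of path components, so a path of
  \<open>X\<close> starting in it never leaves it.\<close>

lemma path_component_of_set_subtopology_tilde:
  assumes "x \<in> tilde X A"
  shows "path_component_of_set (subtopology X (tilde X A)) x = path_component_of_set X x"
proof -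
  have "path_component_of_set X x \<subseteq> tilde X A"
    using assms path_component_of_trans path_component_of_sym path_component_in_topspace
    unfolding tilde_def by (smt (verit) mem_Collect_eq subsetI)
  then show ?thesis
    by (rule arg_cong[OF path_component_of_subtopology_eq[THEN iffD2]])
qed

section \<open>Path components of an H-group\<close>

context H_group
begin

abbreviation cls :: "'a \<Rightarrow> 'a set" where "cls \<equiv> path_component_of_set P"

lemma mult_in: "x \<in> topspace P \<Longrightarrow> y \<in> topspace P \<Longrightarrow> \<mu> (x, y) \<in> topspace P"
  using continuous_map_image_subset_topspace[OF continuous_mult] by auto

lemma inv_in: "x \<in> topspace P \<Longrightarrow> \<eta> x \<in> topspace P"
  using continuous_map_image_subset_topspace[OF continuous_inv] by auto

text \<open>Paths in the two factors combine to a path in the product space, which the continuous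
  map \<open>\<mu>\<close> carries to \<open>P\<close>.\<close>

lemma cls_mult_cong:
  assumes "x \<in> topspace P" "y \<in> topspace P" "cls x = cls x'" "cls y = cls y'"
  shows "cls (\<mu> (x, y)) = cls (\<mu> (x', y'))"
proof -
  have "path_component_of P x x'" "path_component_of P y y'"
    using assms path_component_of_set_eq_iff[of x P x'] path_component_of_set_eq_iff[of y P y']
    by metis+
  then have "(x', y') \<in> path_component_of_set (prod_topology P P) (x, y)"
    by (simp only: path_component_of_pair mem_Sigma_iff mem_Collect_eq)
  then have "path_component_of (prod_topology P P) (x, y) (x', y')"
    by (rule CollectD)
  then have "path_component_of P (\<mu> (x, y)) (\<mu> (x', y'))"
    by (rule path_component_of_continuous_image[OF continuous_mult])
  then show ?thesis
    by (subst path_component_of_set_eq_iff) (blast dest: path_component_in_topspace)+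
qed

text \<open>Each homotopy axiom, evaluated at a point, becomes a group law on components. A closed
  subset \<open>T\<close> is allowed so that the saturated image is covered as well as the whole
  space.\<close>

lemma group_up_to_paths:
  assumes "T \<subseteq> topspace P" "p\<^sub>0 \<in> T"
    and "\<And>x y. x \<in> T \<Longrightarrow> y \<in> T \<Longrightarrow> \<mu> (x, y) \<in> T" "\<And>x. x \<in> T \<Longrightarrow> \<eta> x \<in> T"
  shows "group_up_to T cls \<mu> p\<^sub>0 \<eta>"
proof
  fix x y z assume "x \<in> T" "y \<in> T" "z \<in> T"
  then have "(x, y, z) \<in> topspace (prod_topology P (prod_topology P P))"
    using assms(1) by auto
  from homotopic_with_imp_path_component_of_set_eq[OF associative this]
  show "cls (\<mu> (\<mu> (x, y), z)) = cls (\<mu> (x, \<mu> (y, z)))"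
    by simp
next
  fix x assume "x \<in> T"
  then have x: "x \<in> topspace P"
    using assms(1) by auto
  show "cls (\<mu> (p\<^sub>0, x)) = cls x"
    using homotopic_with_imp_path_component_of_set_eq[OF left_unit x] by simp
  show "cls (\<mu> (\<eta> x, x)) = cls p\<^sub>0"
    using homotopic_with_imp_path_component_of_set_eq[OF left_inverse x] by simp
next
  fix x x' y y' assume "x \<in> T" "y \<in> T" "cls x = cls x'" "cls y = cls y'"
  then show "cls (\<mu> (x, y)) = cls (\<mu> (x', y'))"
    using assms(1) by (intro cls_mult_cong) blast+
qed (use assms in auto)

end

section \<open>The map on path components, its kernel and its image\<close>

context H_homomorphism
begin

abbreviation im :: "'b set" where "im \<equiv> tilde Q (\<phi> ` topspace P)"
abbreviation K :: "'a set" where "K \<equiv> H_kernel P Q q\<^sub>0 \<phi>"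
abbreviation coset :: "'a \<Rightarrow> 'a set" where "coset \<equiv> H_coset P \<mu> \<eta> K"
abbreviation preim :: "'b set \<Rightarrow> 'a set" where "preim A \<equiv> {g \<in> topspace P. \<phi> g \<in> A}"

lemma hom_in: "x \<in> topspace P \<Longrightarrow> \<phi> x \<in> topspace Q"
  using continuous_map_image_subset_topspace[OF continuous_hom] by auto

lemma cls_hom_mult:
  assumes "x \<in> topspace P" "y \<in> topspace P"
  shows "Q.cls (\<phi> (\<mu> (x, y))) = Q.cls (\<mu>\<^sub>2 (\<phi> x, \<phi> y))"
  using homotopic_with_imp_path_component_of_set_eq[OF hom_mult, of "(x, y)"] assms by simp

lemma cls_hom_inv: "x \<in> topspace P \<Longrightarrow> Q.cls (\<phi> (\<eta> x)) = Q.cls (\<eta>\<^sub>2 (\<phi> x))"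
  using homotopic_with_imp_path_component_of_set_eq[OF hom_inv] by simp

sublocale P\<pi>: group_up_to "topspace P" P.cls \<mu> p\<^sub>0 \<eta>
  by (intro P.group_up_to_paths P.base_point P.mult_in P.inv_in order_refl)

sublocale Q\<pi>: group_up_to "topspace Q" Q.cls \<mu>\<^sub>2 q\<^sub>0 \<eta>\<^sub>2
  by (intro Q.group_up_to_paths Q.base_point Q.mult_in Q.inv_in order_refl)

text \<open>As \<open>\<phi>\<close> need not be pointed, this takes an argument: the class of
  \<open>\<phi> p\<^sub>0\<close> is idempotent in the group of components of \<open>Q\<close>,
  hence its unit.\<close>

lemma cls_hom_base_point: "Q.cls (\<phi> p\<^sub>0) = Q.cls q\<^sub>0"
proof -
  interpret G: group Q\<pi>.G by (rule Q\<pi>.group_G)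
  have "Q.cls (\<phi> p\<^sub>0) \<otimes>\<^bsub>Q\<pi>.G\<^esub> Q.cls (\<phi> p\<^sub>0) = Q.cls (\<phi> p\<^sub>0)"
    using cls_hom_mult[OF P.base_point P.base_point]
    unfolding Q\<pi>.mult_G[OF hom_in[OF P.base_point] hom_in[OF P.base_point]] P.pointed_mult
    by (rule sym)
  then show ?thesis
    using G.l_cancel_one[of "Q.cls (\<phi> p\<^sub>0)" "Q.cls (\<phi> p\<^sub>0)"] hom_in[OF P.base_point]
    by (simp add: Q\<pi>.carrier_G Q\<pi>.one_G)
qed

lemma mem_im_iff: "x \<in> im \<longleftrightarrow> x \<in> topspace Q \<and> (\<exists>a\<in>topspace P. Q.cls x = Q.cls (\<phi> a))"
  by (auto simp: tilde_def path_component_of_set_eq_iff)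

text \<open>A path component is already saturated, so membership in its \<open>tilde\<close> is a
  path to \<open>q\<^sub>0\<close> itself.\<close>

lemma mem_kernel_iff: "g \<in> K \<longleftrightarrow> g \<in> topspace P \<and> Q.cls (\<phi> g) = Q.cls q\<^sub>0"
proof -
  have "\<phi> g \<in> tilde Q (Q.cls q\<^sub>0) \<longleftrightarrow> path_component_of Q (\<phi> g) q\<^sub>0" if "g \<in> topspace P"
    using hom_in[OF that] path_component_of_trans path_component_of_sym path_component_of_refl Q.base_point
    unfolding tilde_def by (smt (verit) mem_Collect_eq)
  then show ?thesis
    using hom_in by (simp add: H_kernel_def path_component_of_set_eq_iff cong: conj_cong)
qed

text \<open>The map \<open>\<phi>\<close> carries paths of \<open>P\<close> to paths of
  \<open>Q\<close>, so the kernel is a union of path components.\<close>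

lemma tilde_kernel: "tilde P K = K"
proof
  show "tilde P K \<subseteq> K"
    using path_component_of_set_continuous_image[OF continuous_hom]
    by (auto simp: tilde_def mem_kernel_iff path_component_of_set_eq_iff)
  show "K \<subseteq> tilde P K"
    unfolding tilde_def by (auto simp: H_kernel_def path_component_of_refl)
qed

text \<open>In the group of components of \<open>Q\<close>, the class of
  \<open>\<phi> (\<mu> (\<eta> g, g'))\<close> is the inverse of the class of
  \<open>\<phi> g\<close> times the class of \<open>\<phi> g'\<close>; it is trivial exactly when
  these two classes agree.\<close>

lemma coset_eq_preim:
  assumes "g \<in> topspace P"
  shows "coset g = preim (Q.cls (\<phi> g))"
proof -
  have "Q.cls (\<phi> (\<mu> (\<eta> g, g'))) = Q.cls q\<^sub>0 \<longleftrightarrow> Q.cls (\<phi> g) = Q.cls (\<phi> g')"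
    if "g' \<in> topspace P" for g'
  proof -
    have "Q.cls (\<phi> (\<mu> (\<eta> g, g'))) = Q.cls (\<mu>\<^sub>2 (\<phi> (\<eta> g), \<phi> g'))"
      using assms that by (simp add: cls_hom_mult P.inv_in)
    also have "\<dots> = Q.cls (\<mu>\<^sub>2 (\<eta>\<^sub>2 (\<phi> g), \<phi> g'))"
      using assms that by (intro Q.cls_mult_cong) (simp_all add: hom_in P.inv_in cls_hom_inv)
    finally show ?thesis
      using Q\<pi>.left_quotient_eq_unit_iff assms that by (simp add: hom_in)
  qed
  then show ?thesis
    using assms
    by (simp add: H_coset_def tilde_kernel mem_kernel_iff P.mult_in P.inv_in
        path_component_of_set_eq_iff hom_in cong: conj_cong)
qed

text \<open>Used twice: it makes the product of cosets well defined and makes \<open>preim\<close>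
  injective.\<close>

lemma coset_eq_iff:
  assumes "g \<in> topspace P" "g' \<in> topspace P"
  shows "coset g = coset g' \<longleftrightarrow> Q.cls (\<phi> g) = Q.cls (\<phi> g')"
proof
  assume "coset g = coset g'"
  moreover have "g' \<in> coset g'"
    using assms by (simp add: coset_eq_preim path_component_of_refl hom_in)
  ultimately show "Q.cls (\<phi> g) = Q.cls (\<phi> g')"
    using assms by (auto simp: coset_eq_preim path_component_of_set_eq_iff[OF hom_in])
qed (use assms in \<open>simp add: coset_eq_preim\<close>)

text \<open>The coset map factors through path components, so the laws of \<open>P\<pi>\<close> pass
  to cosets.\<close>

lemma coset_eq_if_cls_eq:
  assumes "g \<in> topspace P" "g' \<in> topspace P" "P.cls g = P.cls g'"
  shows "coset g = coset g'"
  unfolding coset_eq_iff[OF assms(1,2)]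
  by (rule path_component_of_set_continuous_image[OF continuous_hom assms(1,3)])

text \<open>Independence of representatives is checked in \<open>Q\<close>, where a coset is
  determined by the class of a value of \<open>\<phi>\<close>.\<close>

sublocale PK: group_up_to "topspace P" coset \<mu> p\<^sub>0 \<eta>
proof
  fix x x' y y'
  assume in_P: "x \<in> topspace P" "x' \<in> topspace P" "y \<in> topspace P" "y' \<in> topspace P"
    and "coset x = coset x'" "coset y = coset y'"
  then have "Q.cls (\<mu>\<^sub>2 (\<phi> x, \<phi> y)) = Q.cls (\<mu>\<^sub>2 (\<phi> x', \<phi> y'))"
    by (intro Q.cls_mult_cong) (simp_all add: coset_eq_iff hom_in)
  then show "coset (\<mu> (x, y)) = coset (\<mu> (x', y'))"
    using in_P by (simp add: coset_eq_iff P.mult_in cls_hom_mult)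
qed (rule coset_eq_if_cls_eq P\<pi>.assoc P\<pi>.left_unit P\<pi>.left_inverse P.base_point P.mult_in
    P.inv_in | assumption)+

lemma hom_in_im: "g \<in> topspace P \<Longrightarrow> \<phi> g \<in> im"
  by (auto simp: mem_im_iff hom_in)

text \<open>Closure holds because points joined to \<open>\<phi> a\<close> and
  \<open>\<phi> b\<close> have a product joined to \<open>\<phi> (\<mu> (a, b))\<close>; inverses
  are similar, and \<open>q\<^sub>0\<close> is joined to \<open>\<phi> p\<^sub>0\<close>.\<close>

sublocale im: group_up_to im Q.cls \<mu>\<^sub>2 q\<^sub>0 \<eta>\<^sub>2
proof (rule Q.group_up_to_paths)
  show "q\<^sub>0 \<in> im"
    using cls_hom_base_point P.base_point Q.base_point by (auto simp: mem_im_iff)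
next
  fix x y assume "x \<in> im" "y \<in> im"
  then obtain a b where ab: "a \<in> topspace P" "b \<in> topspace P" "x \<in> topspace Q" "y \<in> topspace Q"
      "Q.cls x = Q.cls (\<phi> a)" "Q.cls y = Q.cls (\<phi> b)"
    by (auto simp: mem_im_iff)
  then have "Q.cls (\<mu>\<^sub>2 (x, y)) = Q.cls (\<phi> (\<mu> (a, b)))"
    using Q.cls_mult_cong cls_hom_mult by metis
  then show "\<mu>\<^sub>2 (x, y) \<in> im"
    using ab by (auto simp: mem_im_iff Q.mult_in intro: P.mult_in)
next
  fix x assume "x \<in> im"
  then obtain a where a: "a \<in> topspace P" "x \<in> topspace Q" "Q.cls x = Q.cls (\<phi> a)"
    by (auto simp: mem_im_iff)
  then have "Q.cls (\<eta>\<^sub>2 x) = Q.cls (\<phi> (\<eta> a))"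
    using path_component_of_set_continuous_image[OF Q.continuous_inv] cls_hom_inv by metis
  then show "\<eta>\<^sub>2 x \<in> im"
    using a by (auto simp: mem_im_iff Q.inv_in intro: P.inv_in)
qed (auto simp: tilde_def)

section \<open>The two groups and the isomorphism\<close>

lemma pi0_group_im: "pi0_group (subtopology Q im) q\<^sub>0 \<mu>\<^sub>2 = im.G"
proof -
  have im: "topspace (subtopology Q im) = im"
    by (auto simp: tilde_def)
  have eq: "path_component_of_set (subtopology Q im) x = Q.cls x" if "x \<in> im" for x
    using that by (rule path_component_of_set_subtopology_tilde)
  \<comment> \<open>Components in the subspace and in \<open>Q\<close> agree only at points of
    \<open>im\<close>, so they are exchanged under the bounded quantifiers; closure under
    \<open>\<mu>\<^sub>2\<close> handles the product.\<close>
  have mult_eq: "(\<exists>g\<in>im. \<exists>h\<in>im. A = path_component_of_set (subtopology Q im) g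
        \<and> B = path_component_of_set (subtopology Q im) h
        \<and> C = path_component_of_set (subtopology Q im) (\<mu>\<^sub>2 (g, h)))
      \<longleftrightarrow> (\<exists>g\<in>im. \<exists>h\<in>im. A = Q.cls g \<and> B = Q.cls h \<and> C = Q.cls (\<mu>\<^sub>2 (g, h)))" for A B C
    by (intro bex_cong refl) (simp add: eq im.mult_closed)
  show ?thesis
    unfolding pi0_group_def class_monoid_def path_components_of_def im mult_eq
    by (simp add: eq im.unit_closed cong: image_cong)
qed

lemma H_quotient_kernel: "H_quotient P p\<^sub>0 \<mu> \<eta> K = PK.G"
  by (simp add: H_quotient_def class_monoid_def)

text \<open>Every point of \<open>im\<close> is joined to a value of \<open>\<phi>\<close>, so each
  component can be represented by such a value.\<close>

lemma carrier_im: "carrier im.G = (\<lambda>g. Q.cls (\<phi> g)) ` topspace P"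
proof
  show "carrier im.G \<subseteq> (\<lambda>g. Q.cls (\<phi> g)) ` topspace P"
    by (auto simp: im.carrier_G mem_im_iff)
qed (auto simp: im.carrier_G hom_in_im)

text \<open>Taking preimages involves no choice of representatives. Once a component is written as
  the class of \<open>\<phi> a\<close>, \<open>coset_eq_preim\<close> identifies its preimage with
  the coset of \<open>a\<close>, and every claim reduces to representatives in
  \<open>P\<close>.\<close>

lemma preim_iso: "preim \<in> iso im.G PK.G"
proof (rule isoI)
  show "preim \<in> hom im.G PK.G"
  proof (rule homI)
    fix A assume "A \<in> carrier im.G"
    then show "preim A \<in> carrier PK.G"
      by (auto simp: carrier_im PK.carrier_G coset_eq_preim)
  next
    fix A B assume "A \<in> carrier im.G" "B \<in> carrier im.G"
    then obtain a b where ab: "a \<in> topspace P" "b \<in> topspace P"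
        and AB: "A = Q.cls (\<phi> a)" "B = Q.cls (\<phi> b)"
      unfolding carrier_im by blast
    have "preim (A \<otimes>\<^bsub>im.G\<^esub> B) = preim (Q.cls (\<phi> (\<mu> (a, b))))"
      using ab unfolding AB by (simp only: im.mult_G hom_in_im cls_hom_mult)
    also have "\<dots> = coset (\<mu> (a, b))"
      using ab by (simp only: coset_eq_preim P.mult_in)
    also have "\<dots> = preim A \<otimes>\<^bsub>PK.G\<^esub> preim B"
      using ab unfolding AB by (simp only: PK.mult_G flip: coset_eq_preim)
    finally show "preim (A \<otimes>\<^bsub>im.G\<^esub> B) = preim A \<otimes>\<^bsub>PK.G\<^esub> preim B" .
  qed
  have "inj_on preim (carrier im.G)"
    unfolding carrier_im
  proof (rule inj_onI, elim imageE)
    fix A B a b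
    assume "preim A = preim B" "A = Q.cls (\<phi> a)" "B = Q.cls (\<phi> b)"
      and ab: "a \<in> topspace P" "b \<in> topspace P"
    then show "A = B"
      by (simp only: flip: coset_eq_iff[OF ab] coset_eq_preim)
  qed
  moreover have "preim ` carrier im.G = carrier PK.G"
    unfolding carrier_im PK.carrier_G image_image
    by (intro image_cong refl) (simp only: coset_eq_preim)
  ultimately show "bij_betw preim (carrier im.G) (carrier PK.G)"
    by (simp add: bij_betw_def)
qed

end

theorem theorem4p5:
  fixes P :: "'a topology" and p\<^sub>0 :: 'a and \<mu> :: "'a \<times> 'a \<Rightarrow> 'a" and \<eta> :: "'a \<Rightarrow> 'a"
    and Q :: "'b topology" and q\<^sub>0 :: 'b and \<mu>\<^sub>2 :: "'b \<times> 'b \<Rightarrow> 'b" and \<eta>\<^sub>2 :: "'b \<Rightarrow> 'b"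
    and \<phi> :: "'a \<Rightarrow> 'b" and K :: "'a set"
  assumes "H_homomorphism P p\<^sub>0 \<mu> \<eta> Q q\<^sub>0 \<mu>\<^sub>2 \<eta>\<^sub>2 \<phi>"
    and "K = H_kernel P Q q\<^sub>0 \<phi>"
  shows "group (pi0_group (subtopology Q (tilde Q (\<phi> ` topspace P))) q\<^sub>0 \<mu>\<^sub>2)
    \<and> group (H_quotient P p\<^sub>0 \<mu> \<eta> K)
    \<and> pi0_group (subtopology Q (tilde Q (\<phi> ` topspace P))) q\<^sub>0 \<mu>\<^sub>2 \<cong> H_quotient P p\<^sub>0 \<mu> \<eta> K"
proof -
  interpret H_homomorphism P p\<^sub>0 \<mu> \<eta> Q q\<^sub>0 \<mu>\<^sub>2 \<eta>\<^sub>2 \<phi> by (rule assms)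
  show ?thesis
    unfolding assms(2) pi0_group_im H_quotient_kernel
    using im.group_G PK.group_G preim_iso by (auto intro: is_isoI)
qed

end
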